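(* For every integer $k\ge 0$, $$\frac{\pi}{2}=\arctan\left(\frac{L_{2k+1}}{2}\right)+2\arctan\left(\frac{1}{\phi^{2k+1}}\right).$$
   Context: $\phi=\frac{1+\sqrt5}{2}$ is the Golden mean. $(L_m)_{m\ge0}$ is the sequence of Lucas numbers: $L_0=2$, $L_1=1$, $L_m=L_{m-1}+L_{m-2}$ for $m\ge2$. *)

theory Defs
  imports Complex_Main
begin

definition golden_mean :: real where
  "golden_mean = (1 + sqrt 5) / 2"

fun lucas :: "nat \<Rightarrow> nat" where
  "lucas 0 = 2"
| "lucas (Suc 0) = 1"
| "lucas (Suc (Suc n)) = lucas (Suc n) + lucas n"

end

(* With t = golden_mean ^ -(2k+1) < 1, Binet's formula says that the Lucas number is 1/t - t, so the
   doubling formula gives 2 arctan t = arctan (2t / (1 - t^2)) = arctan (2 / lucas (2k+1)),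
   which is complementary to arctan (lucas (2k+1) / 2). *)
theory Submission
  imports Defs
begin

lemma golden_mean_gt_1: "golden_mean > 1"
  unfolding golden_mean_def by (simp add: real_less_rsqrt)

lemma golden_mean_square: "golden_mean ^ 2 = golden_mean + 1"
  unfolding golden_mean_def by (simp add: power2_eq_square field_simps)

lemma inverse_golden_mean: "1 / golden_mean = golden_mean - 1"
  using golden_mean_gt_1 golden_mean_square by (simp add: power2_eq_square field_simps)

text \<open>Both \<open>golden_mean\<close> and its conjugate \<open>- (1 / golden_mean)\<close> are
  roots of x^2 = x + 1, so their powers obey the Lucas recurrence; the two base cases fix the
  coefficients as 1.\<close>

lemma lucas_Binet: "real (lucas n) = golden_mean ^ n + (- (1 / golden_mean)) ^ n"
proof (induction n rule: lucas.induct)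
  case 2
  show ?case by (simp add: inverse_golden_mean)
next
  case (3 n)
  have conj_square: "(- (1 / golden_mean)) ^ 2 = - (1 / golden_mean) + 1"
    unfolding inverse_golden_mean using golden_mean_square
    by (simp add: power2_eq_square algebra_simps)
  have step: "x ^ Suc (Suc n) = x ^ Suc n + x ^ n" if "x ^ 2 = x + 1" for x :: real
  proof -
    have "x ^ Suc (Suc n) = x ^ 2 * x ^ n" by (simp add: power2_eq_square)
    then show ?thesis using that by (simp add: algebra_simps)
  qed
  show ?case
    unfolding step[OF golden_mean_square] step[OF conj_square] lucas.simps(3) of_nat_add 3 by simp
qed simp

theorem mainTheorem7:
  fixes k :: nat
  shows "pi / 2 = arctan (real (lucas (2 * k + 1)) / 2)
                + 2 * arctan (1 / golden_mean ^ (2 * k + 1))"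
proof -
  define x where "x = golden_mean ^ (2 * k + 1)"
  define L where "L = real (lucas (2 * k + 1))"
  have x: "x > 1"
    unfolding x_def by (rule one_less_power[OF golden_mean_gt_1]) simp
  \<comment> \<open>The exponent 2k+1 is odd, so the conjugate power in Binet's formula is
    negative.\<close>
  have L: "L = x - 1 / x"
    unfolding L_def x_def lucas_Binet by (simp add: power_one_over)
  have "1 / x < 1" using x by simp
  then have "L > 0" using x unfolding L by linarith
  have "x ^ 2 > 1" using x by (rule one_less_power) simp
  have "2 * arctan (1 / x) = arctan (2 * (1 / x) / (1 - (1 / x) ^ 2))"
    using x by (intro arctan_double) simp
  \<comment> \<open>Multiplying numerator and denominator by \<open>x\<close> gives 2 / (x - 1/x);
    \<open>x ^ 2 > 1\<close> keeps the denominators nonzero.\<close>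
  also have "2 * (1 / x) / (1 - (1 / x) ^ 2) = 1 / (L / 2)"
    using x \<open>x ^ 2 > 1\<close> unfolding L by (simp add: field_simps power2_eq_square)
  \<comment> \<open>\<open>arctan_inverse\<close> carries the factor sgn (L / 2), which is 1 since
    \<open>L > 0\<close>.\<close>
  also have "arctan (1 / (L / 2)) = pi / 2 - arctan (L / 2)"
    using \<open>L > 0\<close> arctan_inverse[of "L / 2"] by simp
  finally show ?thesis
    unfolding L_def x_def by simp
qed

end
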